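(* Let $k$ be a field of characteristic $p=3$. Any exponential matrix $A(T)$ of $\mathrm{Mat}(4,k[T])$ is equivalent to one of the following exponential matrices (1), (2), (3), (4), (5), (6): (1) $\begin{pmatrix}1&a&\frac12a^2+b&c\\0&1&a&0\\0&0&1&0\\0&0&0&1\end{pmatrix}$, where $a,b,c$ are $p$-polynomials and $a\ne0$. (2) $\begin{pmatrix}1&0&0&c\\0&1&a&\frac12a^2+b\\0&0&1&a\\0&0&0&1\end{pmatrix}$, where $a,b,c$ are $p$-polynomials and $a\ne0$. (3) $\begin{pmatrix}1&a&b&c\\0&1&0&0\\0&0&1&0\\0&0&0&1\end{pmatrix}$, where $a,b,c$ are $p$-polynomials. (4) $\begin{pmatrix}1&0&a&b\\0&1&c&d\\0&0&1&0\\0&0&0&1\end{pmatrix}$, where $a,b,c,d$ are $p$-polynomials. (5) $\begin{pmatrix}1&0&0&a\\0&1&0&b\\0&0&1&c\\0&0&0&1\end{pmatrix}$, where $a,b,c$ are $p$-polynomials. (6) $\begin{pmatrix}1&a&b&\frac{\lambda}{2}a^2+\mu ab+\frac{\nu}{2}b^2+c\\0&1&0&\lambda a+\mu b\\0&0&1&\mu a+\nu b\\0&0&0&1\end{pmatrix}$, where $a,b,c$ are $p$-polynomials, $a,b$ are linearly independent over $k$, $\lambda,\mu,\nu\in k$, and $\lambda\nu-\mu^2\ne0$.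
   Context: $k[T]$ is the polynomial ring in one variable over $k$. A matrix $A(T)\in\mathrm{Mat}(n,k[T])$ is exponential if $A(0)=I_n$ and $A(T)A(T')=A(T+T')$, where $T,T'$ are indeterminates over $k$. Two matrices $A(T),B(T)\in\mathrm{Mat}(n,k[T])$ are equivalent if $P^{-1}A(T)P=B(T)$ for some $P\in GL(n,k)$. A $p$-polynomial is a polynomial of the form $\sum_{i\ge0}c_iT^{p^i}\in k[T]$ with $c_i\in k$. *)

theory Defs
  imports "HOL-Analysis.Analysis" "HOL-Computational_Algebra.Polynomial"
begin

text \<open>
  A matrix in \<open>Mat(n, k[T])\<close> is a \<open>'a poly ^ 'n ^ 'n\<close>. The ring \<open>k[T, T']\<close> is represented by
  \<open>'a poly poly\<close>, with \<open>T\<close> the inner and \<open>T'\<close> the outer indeterminate. Accordingly, \<open>f(T)\<close> is the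
  constant polynomial with coefficient \<open>f\<close>, and \<open>f(T')\<close> is \<open>f\<close> with its coefficients embedded
  into \<open>k[T]\<close>.
\<close>

definition subst_T :: "'a::field poly \<Rightarrow> 'a poly poly" where
  "subst_T f = [:f:]"

definition subst_T' :: "'a::field poly \<Rightarrow> 'a poly poly" where
  "subst_T' f = map_poly (\<lambda>c. [:c:]) f"

definition subst_sum :: "'a::field poly \<Rightarrow> 'a poly poly" where
  "subst_sum f = pcompose (subst_T' f) [:[:0, 1:], 1:]"

definition exponential_matrix :: "'a::field poly ^ 'n ^ 'n \<Rightarrow> bool" where
  "exponential_matrix A \<longleftrightarrow>
     map_matrix (\<lambda>f. poly f 0) A = mat 1 \<and>
     map_matrix subst_T A ** map_matrix subst_T' A = map_matrix subst_sum A"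

definition equivalent_matrices ::
    "'a::field poly ^ 'n ^ 'n \<Rightarrow> 'a poly ^ 'n ^ 'n \<Rightarrow> bool" where
  "equivalent_matrices A B \<longleftrightarrow>
     (\<exists>P :: 'a ^ 'n ^ 'n. invertible P \<and>
        map_matrix (\<lambda>c. [:c:]) (matrix_inv P) ** A ** map_matrix (\<lambda>c. [:c:]) P = B)"

definition p_polynomial :: "'a::field poly \<Rightarrow> bool" where
  "p_polynomial f \<longleftrightarrow> (\<exists>(c :: nat \<Rightarrow> 'a) m. f = (\<Sum>i\<le>m. monom (c i) (CHAR('a) ^ i)))"

definition lin_indep2 :: "'a::field poly \<Rightarrow> 'a poly \<Rightarrow> bool" where
  "lin_indep2 a b \<longleftrightarrow>
     (\<forall>\<alpha> \<beta>. smult \<alpha> a + smult \<beta> b = 0 \<longrightarrow> \<alpha> = 0 \<and> \<beta> = 0)"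

definition form1 :: "('a::field poly ^ 4 ^ 4) set" where
  "form1 =
     {vector [vector [1, a, smult (1 / 2) (a\<^sup>2) + b, c],
              vector [0, 1, a, 0],
              vector [0, 0, 1, 0],
              vector [0, 0, 0, 1]] | a b c.
        p_polynomial a \<and> p_polynomial b \<and> p_polynomial c \<and> a \<noteq> 0}"

definition form2 :: "('a::field poly ^ 4 ^ 4) set" where
  "form2 =
     {vector [vector [1, 0, 0, c],
              vector [0, 1, a, smult (1 / 2) (a\<^sup>2) + b],
              vector [0, 0, 1, a],
              vector [0, 0, 0, 1]] | a b c.
        p_polynomial a \<and> p_polynomial b \<and> p_polynomial c \<and> a \<noteq> 0}"

definition form3 :: "('a::field poly ^ 4 ^ 4) set" where
  "form3 =
     {vector [vector [1, a, b, c],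
              vector [0, 1, 0, 0],
              vector [0, 0, 1, 0],
              vector [0, 0, 0, 1]] | a b c.
        p_polynomial a \<and> p_polynomial b \<and> p_polynomial c}"

definition form4 :: "('a::field poly ^ 4 ^ 4) set" where
  "form4 =
     {vector [vector [1, 0, a, b],
              vector [0, 1, c, d],
              vector [0, 0, 1, 0],
              vector [0, 0, 0, 1]] | a b c d.
        p_polynomial a \<and> p_polynomial b \<and> p_polynomial c \<and> p_polynomial d}"

definition form5 :: "('a::field poly ^ 4 ^ 4) set" where
  "form5 =
     {vector [vector [1, 0, 0, a],
              vector [0, 1, 0, b],
              vector [0, 0, 1, c],
              vector [0, 0, 0, 1]] | a b c.
        p_polynomial a \<and> p_polynomial b \<and> p_polynomial c}"

definition form6 :: "('a::field poly ^ 4 ^ 4) set" where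
  "form6 =
     {vector [vector [1, a, b, smult (l / 2) (a\<^sup>2) + smult m (a * b) + smult (n / 2) (b\<^sup>2) + c],
              vector [0, 1, 0, smult l a + smult m b],
              vector [0, 0, 1, smult m a + smult n b],
              vector [0, 0, 0, 1]] | a b c l m n.
        p_polynomial a \<and> p_polynomial b \<and> p_polynomial c \<and>
        lin_indep2 a b \<and> l * n - m\<^sup>2 \<noteq> 0}"

end

theory Submission
  imports Defs
begin

text \<open>
  Write \<open>A = \<Sum>n. M\<^sub>n T^n\<close>. Exponentiality means \<open>M\<^sub>0 = 1\<close> and \<open>M\<^sub>i M\<^sub>j = (i + j choose i) M\<^bsub>i+j\<^esub>\<close>; so the
  \<open>M\<^sub>n\<close> commute, and \<open>M\<^sub>n^3 = 0\<close> for \<open>n > 0\<close> in characteristic 3. Consider the matrices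
  \<open>M\<^sub>i + M\<^sub>j\<close> with \<open>i, j > 0\<close>, whose cubes vanish as well. If all their squares are 0, then polarization
  gives \<open>M\<^sub>i M\<^sub>j = 0\<close>, the images of the \<open>M\<^sub>n\<close> span a subspace \<open>W\<close> that all of them annihilate, and
  a basis adapted to \<open>W\<close> yields form (3), (4) or (5) according to \<open>dim W\<close>. Otherwise some
  \<open>X = M\<^sub>i + M\<^sub>j\<close> has Jordan type \<open>(3, 1)\<close>, and the nilpotent elements of its commutant
  form a four-parameter family. In a Jordan basis \<open>A\<close> then has first row \<open>1, b, e, c\<close> and last column
  \<open>c, b, d, 1\<close>, and commutativity forces \<open>d\<close> and \<open>e\<close> to be proportional. The case \<open>d = 0\<close> is
  form (1), \<open>e = 0\<close> is form (2), and \<open>d = t e \<noteq> 0\<close> is form (6) with \<open>\<lambda> = 1\<close>, \<open>\<mu> = 0\<close>, \<open>\<nu> = t\<close>.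
\<close>

lemma vector_4 [simp]:
  "(vector [x, y, z, w] :: 'a::zero ^ 4) $ 1 = x"
  "(vector [x, y, z, w] :: 'a::zero ^ 4) $ 2 = y"
  "(vector [x, y, z, w] :: 'a::zero ^ 4) $ 3 = z"
  "(vector [x, y, z, w] :: 'a::zero ^ 4) $ 4 = w"
  unfolding vector_def by simp_all

section \<open>Substitutions and additive polynomials\<close>

text \<open>Embeds \<open>k\<close> into \<open>k[T, T']\<close>. All three substitutions turn
  \<open>smult c\<close> into multiplication by \<open>const2 c\<close>, so identities between
  substituted polynomials become plain ring identities.\<close>

definition const2 :: "'a::field \<Rightarrow> 'a poly poly" where
  "const2 c = [:[:c:]:]"

lemma subst_T_simps [simp]:
  "subst_T 0 = 0" "subst_T 1 = 1"
  "subst_T (f + g) = subst_T f + subst_T g"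
  "subst_T (f - g) = subst_T f - subst_T g"
  "subst_T (f * g) = subst_T f * subst_T g"
  "subst_T (smult c f) = const2 c * subst_T f"
  by (simp_all add: subst_T_def const2_def)

lemma coeff_subst_T' [simp]: "coeff (subst_T' f) n = [:coeff f n:]"
  by (simp add: subst_T'_def coeff_map_poly)

lemma subst_T'_simps [simp]:
  fixes f g :: "'a::field poly"
  shows "subst_T' (0 :: 'a poly) = 0" "subst_T' (1 :: 'a poly) = 1"
  "subst_T' (f + g) = subst_T' f + subst_T' g"
  "subst_T' (f - g) = subst_T' f - subst_T' g"
  "subst_T' (f * g) = subst_T' f * subst_T' g"
  "subst_T' (smult c f) = const2 c * subst_T' f"
proof -
  have sum: "[:\<Sum>i\<in>S. h i:] = (\<Sum>i\<in>S. [:h i:])" for S and h :: "nat \<Rightarrow> 'a"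
    by (intro poly_eqI) (simp add: coeff_sum coeff_pCons split: nat.splits)
  show "subst_T' (f * g) = subst_T' f * subst_T' g"
    by (intro poly_eqI) (simp add: coeff_mult sum mult.commute)
  show "subst_T' (1 :: 'a poly) = 1"
    by (simp add: subst_T'_def flip: one_pCons)
qed (intro poly_eqI, simp add: mult.commute const2_def)+

lemma subst_sum_simps [simp]:
  "subst_sum 0 = 0" "subst_sum 1 = 1"
  "subst_sum (f + g) = subst_sum f + subst_sum g"
  "subst_sum (f - g) = subst_sum f - subst_sum g"
  "subst_sum (f * g) = subst_sum f * subst_sum g"
  "subst_sum (smult c f) = const2 c * subst_sum f"
  by (simp_all add: subst_sum_def pcompose_add pcompose_diff pcompose_mult pcompose_smult
    pcompose_1 const2_def)

lemma subst_2 [simp]: "subst_T 2 = 2" "subst_T' 2 = 2" "subst_sum 2 = 2"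
  by (simp_all only: one_add_one [symmetric] subst_T_simps subst_T'_simps subst_sum_simps)

lemma subst_sum_sum: "subst_sum (\<Sum>i\<in>I. f i) = (\<Sum>i\<in>I. subst_sum (f i))"
  by (induction I rule: infinite_finite_induct) auto

lemma pcompose_monom: "pcompose (monom c n) q = smult c (q ^ n)"
  by (induction n) (simp_all add: monom_Suc pcompose_pCons monom_0)

text \<open>The coefficient of \<open>T^i T'^j\<close> in \<open>f(T + T')\<close>: only the
  monomial of degree \<open>i + j\<close> contributes, by the binomial theorem. The outer index
  \<open>j\<close> belongs to \<open>T'\<close>, the inner index \<open>i\<close> to
  \<open>T\<close>.\<close>

lemma coeff_subst_sum:
  "coeff (coeff (subst_sum f) j) i = of_nat ((i + j) choose i) * coeff f (i + j)"
proof -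
  have monom: "subst_sum (monom c n) = smult [:c:] ([:[:0, 1:], 1:] ^ n)" for c :: 'a and n
    by (simp add: subst_sum_def subst_T'_def map_poly_monom pcompose_monom)
  have X: "[:0, 1:] ^ n = monom (1::'a) n" for n
    by (simp add: monom_altdef)
  have coeff_monom: "coeff (coeff (subst_sum (monom c n)) j) i
      = (if n = i + j then of_nat (n choose i) * c else 0)" for c :: 'a and n
  proof (cases "j \<le> n")
    case True
    then show ?thesis
      using binomial_symmetric [of i "i + j"]
      by (auto simp: monom coeff_linear_poly_power X of_nat_poly mult_ac)
  next
    case False
    then show ?thesis
      by (simp add: monom coeff_eq_0 degree_linear_power)
  qed
  have "f = (\<Sum>n\<le>degree f. monom (coeff f n) n)"
    by (simp add: poly_as_sum_of_monoms)
  then have "subst_sum f = (\<Sum>n\<le>degree f. subst_sum (monom (coeff f n) n))"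
    by (metis subst_sum_sum)
  then have "coeff (coeff (subst_sum f) j) i
      = (\<Sum>n\<le>degree f. if n = i + j then of_nat (n choose i) * coeff f n else 0)"
    by (simp add: coeff_sum coeff_monom)
  also have "\<dots> = of_nat ((i + j) choose i) * coeff f (i + j)"
    by (auto simp: sum.delta coeff_eq_0)
  finally show ?thesis .
qed

text \<open>The working substitute for \<open>p_polynomial\<close>: matrix multiplication yields
  this identity directly, and the two notions agree in prime characteristic.\<close>

definition additive_poly :: "'a::field poly \<Rightarrow> bool" where
  "additive_poly f \<longleftrightarrow> subst_sum f = subst_T f + subst_T' f"

lemma additive_polyI: "subst_sum f = subst_T f + subst_T' f \<Longrightarrow> additive_poly f"
  by (simp add: additive_poly_def)

text \<open>With \<open>k = p^m\<close>, compare the coefficients of \<open>T^k\<close> in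
  \<open>(1 + T)^(k q) = (1 + T^k)^q\<close>; on the right only the linear term of the binomial
  expansion reaches this degree.\<close>

lemma choose_prime_power_multiple:
  assumes "prime CHAR('a::field)"
  shows "of_nat ((CHAR('a) ^ m * q) choose (CHAR('a) ^ m)) = (of_nat q :: 'a)"
proof -
  let ?k = "CHAR('a) ^ m"
  have k: "?k > 0" using assms by (simp add: prime_gt_0_nat)
  have "[:1, 1::'a:] = monom 1 1 + 1"
    by (simp add: monom_altdef one_pCons)
  then have "[:1, 1::'a:] ^ ?k = monom 1 1 ^ ?k + 1 ^ ?k"
    using freshmans_dream' [where 'a = "'a poly"] assms by (metis semiring_char_poly)
  then have "[:1, 1::'a:] ^ (?k * q) = (monom 1 ?k + 1) ^ q"
    by (simp add: power_mult monom_power)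
  also have "\<dots> = (\<Sum>j\<le>q. of_nat (q choose j) * monom 1 (?k * j))"
    by (simp add: binomial_ring monom_power mult.commute)
  finally have "coeff ([:1, 1::'a:] ^ (?k * q)) ?k
      = (\<Sum>j\<le>q. of_nat (q choose j) * (if j = 1 then 1 else 0))"
    using k by (auto simp: coeff_sum of_nat_poly intro!: sum.cong)
  also have "\<dots> = of_nat q"
    by (cases q) (simp_all add: if_distrib [of "\<lambda>x. _ * x"] sum.delta cong: if_cong)
  finally show ?thesis
    using k by (cases "q = 0") (simp_all add: coeff_linear_poly_power binomial_eq_0)
qed

text \<open>Write \<open>n = p^m q\<close> with \<open>q\<close> prime to \<open>p\<close>. If
  \<open>q > 1\<close>, then \<open>n choose p^m\<close> is an interior binomial coefficient
  congruent to \<open>q\<close>, hence nonzero.\<close>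

lemma choose_zero_imp_prime_power:
  assumes p: "prime CHAR('a::field)" and n: "n > 0"
    and choose: "\<And>i. 0 < i \<Longrightarrow> i < n \<Longrightarrow> of_nat (n choose i) = (0::'a)"
  shows "\<exists>m. n = CHAR('a) ^ m"
proof -
  obtain m q where q: "n = CHAR('a) ^ m * q" "\<not> CHAR('a) dvd q"
    using multiplicity_decompose' [of n "CHAR('a)"] n p
    by (metis not_gr_zero not_prime_unit)
  have "q \<noteq> 0" using q(1) n by auto
  have "\<not> CHAR('a) ^ m < n"
    using choose [of "CHAR('a) ^ m"] choose_prime_power_multiple [OF p, of m q] q p
    by (auto simp: prime_gt_0_nat of_nat_eq_0_iff_char_dvd)
  with q \<open>q \<noteq> 0\<close> p have "q = 1"
    by (cases q; cases "q - 1") (auto simp: prime_gt_0_nat)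
  with q show ?thesis by auto
qed

text \<open>Comparing mixed coefficients, \<open>coeff f n\<close> is annihilated by every interior
  \<open>n choose i\<close>, so the support of \<open>f\<close> consists of powers of
  \<open>p\<close>.\<close>

lemma additive_poly_imp_p_polynomial:
  fixes f :: "'a::field poly"
  assumes p: "prime CHAR('a)" and f: "additive_poly f"
  shows "p_polynomial f"
proof -
  let ?p = "CHAR('a)"
  have eq: "of_nat ((i + j) choose i) * coeff f (i + j)
      = (if j = 0 then coeff f i else 0) + (if i = 0 then coeff f j else 0)" for i j
    using f coeff_subst_sum [of f j i]
    by (auto simp: additive_poly_def subst_T_def coeff_pCons split: nat.splits)
  have "(2::'a) \<noteq> 1"
    by (metis add_cancel_right_right one_add_one one_neq_zero)
  then have f0: "coeff f 0 = 0" using eq [of 0 0] by simp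
  have supp: "\<exists>m. n = ?p ^ m" if n: "coeff f n \<noteq> 0" for n
  proof (rule choose_zero_imp_prime_power [OF p])
    show "n > 0" using n f0 by (cases n) auto
    fix i assume "0 < i" "i < n"
    then show "of_nat (n choose i) = (0::'a)"
      using eq [of i "n - i"] n by auto
  qed
  have "f = (\<Sum>m\<le>degree f. monom (coeff f (?p ^ m)) (?p ^ m))"
  proof (rule poly_eqI)
    fix n
    have inj: "?p ^ m = ?p ^ k \<longleftrightarrow> m = k" for m k
      using prime_gt_1_nat [OF p] by simp
    show "coeff f n = coeff (\<Sum>m\<le>degree f. monom (coeff f (?p ^ m)) (?p ^ m)) n"
    proof (cases "\<exists>m. n = ?p ^ m")
      case True
      then obtain k where k: "n = ?p ^ k" by blast
      \<comment> \<open>The range of summation is wide enough because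
        \<open>k < 2^k \<le> p^k = n \<le> degree f\<close>.\<close>
      have "k \<le> degree f" if "coeff f n \<noteq> 0"
        using le_degree [OF that] less_exp [of k] power_mono [of 2 ?p k] prime_ge_2_nat [OF p] k
        by linarith
      then show ?thesis
        by (auto simp: coeff_sum k inj sum.delta')
    next
      case False
      then have "coeff f n = 0" using supp by blast
      moreover have "coeff (\<Sum>m\<le>degree f. monom (coeff f (?p ^ m)) (?p ^ m)) n = 0"
        using False by (auto simp: coeff_sum intro!: sum.neutral)
      ultimately show ?thesis by simp
    qed
  qed
  then show ?thesis unfolding p_polynomial_def
    by (intro exI [of _ "\<lambda>m. coeff f (?p ^ m)"] exI [of _ "degree f"])
qed

text \<open>The Frobenius identity \<open>(T + T')^(p^i) = T^(p^i) + T'^(p^i)\<close> in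
  \<open>k[T, T']\<close> settles monomials, and additivity is stable under sums.\<close>

lemma p_polynomial_imp_additive_poly:
  fixes f :: "'a::field poly"
  assumes p: "prime CHAR('a)" and f: "p_polynomial f"
  shows "additive_poly f"
proof -
  obtain c m where f: "f = (\<Sum>i\<le>m. monom (c i) (CHAR('a) ^ i))"
    using f by (auto simp: p_polynomial_def)
  have monom: "additive_poly (monom a (CHAR('a) ^ i))" for a :: 'a and i
  proof -
    have "[:[:0, 1:], 1::'a poly:] = monom 1 1 + [:monom 1 1:]"
      by (simp add: monom_altdef)
    moreover have "prime CHAR('a poly poly)" using p by simp
    ultimately have "[:[:0, 1:], 1::'a poly:] ^ (CHAR('a) ^ i)
        = monom 1 1 ^ (CHAR('a) ^ i) + [:monom (1::'a) 1:] ^ (CHAR('a) ^ i)"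
      using freshmans_dream' [where 'a = "'a poly poly"] by (metis semiring_char_poly)
    then have "[:[:0, 1:], 1::'a poly:] ^ (CHAR('a) ^ i)
        = monom 1 (CHAR('a) ^ i) + [:monom 1 (CHAR('a) ^ i):]"
      by (simp add: monom_power poly_const_pow)
    then show ?thesis
      by (simp add: additive_poly_def subst_sum_def subst_T_def subst_T'_def map_poly_monom
        pcompose_monom smult_add_right smult_monom add.commute)
  qed
  have "additive_poly (\<Sum>i\<in>I. monom (c i) (CHAR('a) ^ i))" if "finite I" for I
    using that
  proof induction
    case (insert x F)
    then show ?case using monom [of "c x" x] by (simp add: additive_poly_def)
  qed (simp add: additive_poly_def)
  then show ?thesis using f by simp
qed

text \<open>
  Halving \<open>a\<close> clears the denominators in \<open>a\<^sup>2 / 2\<close>, which turns the identities for the normal forms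
  into plain ring identities.
\<close>

lemma additive_poly_half:
  fixes a :: "'a::field poly"
  assumes two: "(2::'a) \<noteq> 0" and a: "additive_poly a"
  obtains h where "additive_poly h" "a = h + h"
    "\<And>c. smult (c / 2) (a\<^sup>2) = smult c (h * h) + smult c (h * h)"
proof
  let ?h = "smult (1 / 2) a"
  show "additive_poly ?h"
    using a by (simp add: additive_poly_def distrib_left)
  have "?h + ?h = smult (1 / 2 + 1 / 2) a"
    by (rule smult_add_left [symmetric])
  then show a_eq: "a = ?h + ?h"
    using two by (simp add: field_simps)
  fix c
  have "smult (c / 2) (a\<^sup>2) = smult c (?h * a)"
    by (simp add: power2_eq_square)
  also have "\<dots> = smult c (?h * (?h + ?h))"
    by (metis a_eq)
  finally show "smult (c / 2) (a\<^sup>2) = smult c (?h * ?h) + smult c (?h * ?h)"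
    by (simp only: distrib_left smult_add_right)
qed

lemma poly_0_additive: "additive_poly (f :: 'a::field poly) \<Longrightarrow> poly f 0 = 0"
proof -
  assume "additive_poly f"
  then have "coeff (coeff (subst_sum f) 0) 0 = coeff (coeff (subst_T f + subst_T' f) 0) 0"
    by (simp add: additive_poly_def)
  then have "coeff f 0 = coeff f 0 + coeff f 0"
    by (simp only: coeff_subst_sum) (simp add: subst_T_def)
  then show "poly f 0 = 0"
    by (metis add_cancel_right_right poly_0_coeff_0)
qed

section \<open>The coefficient matrices of an exponential matrix\<close>

text \<open>The matrix \<open>M\<^sub>n\<close> of the overview.\<close>

definition coeff_matrix :: "'a::field poly ^ 'n ^ 'n \<Rightarrow> nat \<Rightarrow> 'a ^ 'n ^ 'n" where
  "coeff_matrix A n = map_matrix (\<lambda>f. coeff f n) A"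

definition const_matrix :: "'a::field ^ 'n ^ 'n \<Rightarrow> 'a poly ^ 'n ^ 'n" where
  "const_matrix P = map_matrix (\<lambda>c. [:c:]) P"

lemma coeff_matrix_nth [simp]: "coeff_matrix A n $ i $ j = coeff (A $ i $ j) n"
  by (simp add: coeff_matrix_def)

lemma const_matrix_nth [simp]: "const_matrix P $ i $ j = [:P $ i $ j:]"
  by (simp add: const_matrix_def)

lemma coeff_matrix_mult_const:
  "coeff_matrix (const_matrix P ** A) n = P ** coeff_matrix A n"
  "coeff_matrix (A ** const_matrix P) n = coeff_matrix A n ** P"
  by (simp_all add: vec_eq_iff matrix_matrix_mult_def coeff_sum mult.commute)

lemma coeff_matrix_eqI: "(\<And>n. coeff_matrix A n = coeff_matrix B n) \<Longrightarrow> A = B"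
  by (simp add: vec_eq_iff poly_eq_iff)

lemma const_matrix_mult: "const_matrix (P ** Q) = const_matrix P ** const_matrix Q"
  by (rule coeff_matrix_eqI, subst coeff_matrix_mult_const)
    (simp add: vec_eq_iff matrix_matrix_mult_def coeff_sum coeff_pCons split: nat.split)

lemma const_matrix_1: "const_matrix (mat 1) = mat 1"
  by (simp add: vec_eq_iff mat_def one_pCons)

text \<open>The entrywise form, used to verify the normal forms and to read off how single entries
  behave under \<open>T + T'\<close>.\<close>

lemma exponential_matrix_iff_subst:
  "exponential_matrix A \<longleftrightarrow>
     (\<forall>r s. poly (A $ r $ s) 0 = (if r = s then 1 else 0)) \<and>
     (\<forall>r s. (\<Sum>k\<in>UNIV. subst_T (A $ r $ k) * subst_T' (A $ k $ s)) = subst_sum (A $ r $ s))"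
  by (simp add: exponential_matrix_def vec_eq_iff mat_def matrix_matrix_mult_def)

text \<open>The form over \<open>k\<close>: comparing the coefficients of \<open>T^i T'^j\<close>
  gives the multiplication table of the \<open>M\<^sub>n\<close>.\<close>

lemma exponential_matrix_iff_coeff:
  "exponential_matrix A \<longleftrightarrow> coeff_matrix A 0 = mat 1 \<and>
     (\<forall>i j. coeff_matrix A i ** coeff_matrix A j
        = map_matrix (\<lambda>c. of_nat ((i + j) choose i) * c) (coeff_matrix A (i + j)))"
proof -
  have "(\<Sum>k\<in>UNIV. subst_T (A $ r $ k) * subst_T' (A $ k $ s)) = subst_sum (A $ r $ s) \<longleftrightarrow>
      (\<forall>i j. (\<Sum>k\<in>UNIV. coeff (A $ r $ k) i * coeff (A $ k $ s) j)
        = of_nat ((i + j) choose i) * coeff (A $ r $ s) (i + j))" for r s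
    by (auto simp: poly_eq_iff subst_T_def coeff_subst_sum coeff_sum mult_ac)
  then show ?thesis
    by (auto simp: exponential_matrix_iff_subst vec_eq_iff mat_def matrix_matrix_mult_def
      poly_0_coeff_0)
qed

section \<open>Conjugation by constant matrices\<close>

lemma map_matrix_scale_mult:
  fixes M :: "'a::field ^ 'n ^ 'n"
  shows "P ** map_matrix ((*) c) M ** Q = map_matrix ((*) c) (P ** M ** Q)"
  by (simp add: vec_eq_iff matrix_matrix_mult_def sum_distrib_left sum_distrib_right mult_ac)

lemma matrix_inv_mult:
  fixes P :: "'a::field ^ 'n ^ 'n"
  assumes "invertible P"
  shows "P ** matrix_inv P = mat 1" "matrix_inv P ** P = mat 1"
  using someI_ex [OF assms [unfolded invertible_def]] by (simp_all add: matrix_inv_def)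

lemma equivalent_matricesI:
  assumes P: "invertible P" and eq: "A ** const_matrix P = const_matrix P ** B"
  shows "equivalent_matrices A B"
proof -
  have "matrix_inv P ** P = mat 1" using matrix_inv_mult(2) [OF P] .
  then have "const_matrix (matrix_inv P) ** A ** const_matrix P = B"
    by (metis eq const_matrix_mult const_matrix_1 matrix_mul_assoc matrix_mul_lid)
  with P show ?thesis
    unfolding equivalent_matrices_def const_matrix_def by blast
qed

lemma equivalent_matricesE:
  assumes "equivalent_matrices A B"
  obtains P where "invertible P" "A ** const_matrix P = const_matrix P ** B"
proof -
  obtain P where P: "invertible P" and B: "const_matrix (matrix_inv P) ** A ** const_matrix P = B"
    using assms unfolding equivalent_matrices_def const_matrix_def by blast
  have "P ** matrix_inv P = mat 1" using matrix_inv_mult(1) [OF P] .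
  then have "A ** const_matrix P = const_matrix P ** B"
    by (metis B const_matrix_mult const_matrix_1 matrix_mul_assoc matrix_mul_lid)
  with P that show thesis by blast
qed

lemma equivalent_matrices_trans:
  assumes "equivalent_matrices A B" "equivalent_matrices B C"
  shows "equivalent_matrices A C"
proof -
  obtain P Q where "invertible P" "A ** const_matrix P = const_matrix P ** B"
    "invertible Q" "B ** const_matrix Q = const_matrix Q ** C"
    using assms by (metis equivalent_matricesE)
  then show ?thesis
    by (intro equivalent_matricesI [of "P ** Q"])
      (auto simp: invertible_mult const_matrix_mult, metis matrix_mul_assoc)
qed

lemma exponential_matrix_conj:
  assumes P: "invertible P" and A: "exponential_matrix A"
  shows "exponential_matrix (const_matrix (matrix_inv P) ** A ** const_matrix P)"
proof -
  let ?Q = "matrix_inv P"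
  have QP: "?Q ** P = mat 1" and PQ: "P ** ?Q = mat 1"
    using matrix_inv_mult [OF P] by blast+
  have mult: "?Q ** M ** P ** (?Q ** N ** P) = ?Q ** (M ** N) ** P" for M N
    by (metis PQ matrix_mul_assoc matrix_mul_lid)
  show ?thesis
    using A QP by (simp add: exponential_matrix_iff_coeff coeff_matrix_mult_const mult
      map_matrix_scale_mult)
qed

section \<open>The normal forms are exponential\<close>

lemma forms_exponential:
  fixes B :: "'a::field poly ^ 4 ^ 4"
  assumes p: "prime CHAR('a)" and two: "(2::'a) \<noteq> 0"
    and B: "B \<in> form1 \<union> form2 \<union> form3 \<union> form4 \<union> form5 \<union> form6"
  shows "exponential_matrix B"
proof -
  note ex = exponential_matrix_iff_subst forall_4 sum_4
  have pp: "subst_sum f = subst_T f + subst_T' f" "poly f 0 = 0" if "additive_poly f" for f :: "'a poly"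
    using that poly_0_additive by (auto simp: additive_poly_def)
  have ad: "additive_poly f" if "p_polynomial f" for f :: "'a poly"
    using p_polynomial_imp_additive_poly [OF p that] .
  have half: "const2 l = const2 (l / 2) + const2 (l / 2)" for l :: 'a
    using two by (simp add: const2_def field_simps)
  consider "B \<in> form1" | "B \<in> form2" | "B \<in> form3" | "B \<in> form4" | "B \<in> form5" | "B \<in> form6"
    using B by blast
  then show ?thesis
  proof cases
    case 1
    then obtain a b c where *: "p_polynomial a" "p_polynomial b" "p_polynomial c"
      and B: "B = vector [vector [1, a, smult (1 / 2) (a\<^sup>2) + b, c],
              vector [0, 1, a, 0], vector [0, 0, 1, 0], vector [0, 0, 0, 1]]"
      unfolding form1_def by blast
    obtain H where H: "additive_poly H" "a = H + H"
        "\<And>c. smult (c / 2) (a\<^sup>2) = smult c (H * H) + smult c (H * H)"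
      using additive_poly_half [OF two ad [OF *(1)]] by blast
    \<comment> \<open>The order matters: \<open>H(3)\<close> removes the fraction while
      \<open>a\<close> is still visible, and only then is \<open>a\<close> replaced by
      \<open>H + H\<close>.\<close>
    show ?thesis unfolding B ex H(3) unfolding H(2)
      by (simp add: pp ad * H(1) algebra_simps)
  next
    case 2
    then obtain a b c where *: "p_polynomial a" "p_polynomial b" "p_polynomial c"
      and B: "B = vector [vector [1, 0, 0, c], vector [0, 1, a, smult (1 / 2) (a\<^sup>2) + b],
              vector [0, 0, 1, a], vector [0, 0, 0, 1]]"
      unfolding form2_def by blast
    obtain H where H: "additive_poly H" "a = H + H"
        "\<And>c. smult (c / 2) (a\<^sup>2) = smult c (H * H) + smult c (H * H)"
      using additive_poly_half [OF two ad [OF *(1)]] by blast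
    show ?thesis unfolding B ex H(3) unfolding H(2)
      by (simp add: pp ad * H(1) algebra_simps)
  next
    case 6
    then obtain a b c l m n where *: "p_polynomial a" "p_polynomial b" "p_polynomial c"
      and B: "B = vector [vector [1, a, b,
                smult (l / 2) (a\<^sup>2) + smult m (a * b) + smult (n / 2) (b\<^sup>2) + c],
              vector [0, 1, 0, smult l a + smult m b],
              vector [0, 0, 1, smult m a + smult n b], vector [0, 0, 0, 1]]"
      unfolding form6_def by blast
    \<comment> \<open>Here the scalars \<open>l\<close> and \<open>n\<close> are halved instead of
      the polynomials, so that all terms are expressed through \<open>l / 2\<close> and
      \<open>n / 2\<close>. Fixing the instances keeps the rewriting from looping.\<close>
    show ?thesis unfolding B ex
      by (simp add: pp ad * power2_eq_square half [of l] half [of n] algebra_simps)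
  qed (auto simp: form3_def form4_def form5_def ex pp ad add.commute)
qed

section \<open>Adapted bases\<close>

lemma column_eq_mult_axis: "column j P = P *v axis j (1::'a::field)"
  by (simp add: column_def vec_eq_iff matrix_vector_mult_def axis_def if_distrib sum.delta cong: if_cong)

text \<open>A basis of \<open>W\<close> is extended to the whole space and its vectors are placed in
  the columns indexed by \<open>I\<close>. Coordinates outside \<open>I\<close> then vanish on that
  basis, hence on its span.\<close>

lemma adapted_basis:
  fixes W :: "('a::field ^ 'n) set" and I :: "'n set"
  assumes I: "card I = vec.dim W"
  obtains P where "invertible P"
    "\<And>v i. v \<in> W \<Longrightarrow> i \<notin> I \<Longrightarrow> (matrix_inv P *v v) $ i = 0"
    "\<And>i. i \<in> I \<Longrightarrow> column i P \<in> W"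
proof -
  obtain B where B: "B \<subseteq> W" "vec.independent B" "W \<subseteq> vec.span B" "card B = vec.dim W"
    using vec.basis_exists by blast
  obtain B' where B': "B \<subseteq> B'" "vec.independent B'" "vec.span B' = UNIV"
    using vec.maximal_independent_subset_extend [OF subset_UNIV B(2)] by (metis top.extremum_uniqueI)
  have fin: "finite B'" "finite B"
    using B'(2) B(2) vec.finiteI_independent by auto
  have card: "card B' = CARD('n)"
    using B'(2,3) by (metis vec.dim_eq_card_independent vec.dim_span vec_dim_card)
  obtain h1 where h1: "bij_betw h1 I B"
    using finite_same_card_bij [of I B] fin I B(4) by auto
  have "card (- I) = card (B' - B)"
    using I B(4) card fin B'(1) by (simp add: Compl_eq_Diff_UNIV card_Diff_subset)
  then obtain h2 where h2: "bij_betw h2 (- I) (B' - B)"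
    using finite_same_card_bij [of "- I" "B' - B"] fin by auto
  define h where "h i = (if i \<in> I then h1 i else h2 i)" for i
  have hI: "bij_betw h I B"
    using bij_betw_cong [of I h h1 B] h1 by (simp add: h_def)
  moreover have "bij_betw h (- I) (B' - B)"
    using bij_betw_cong [of "- I" h h2 "B' - B"] h2 by (simp add: h_def)
  ultimately have h: "bij_betw h UNIV B'"
    using bij_betw_combine [of h I B "- I" "B' - B"] B'(1) by (simp add: Un_absorb1)
  define P :: "'a ^ 'n ^ 'n" where "P = (\<chi> i j. h j $ i)"
  have col: "column j P = h j" for j
    by (simp add: column_def P_def vec_eq_iff)
  have "c i = 0" if "(\<Sum>i\<in>UNIV. c i *s column i P) = 0" for c i
  proof -
    \<comment> \<open>Independence is known for the set \<open>B'\<close>, so a relation between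
      columns is reindexed along the bijection \<open>h\<close>.\<close>
    have "(\<Sum>v\<in>B'. c (inv_into UNIV h v) *s v) = (\<Sum>i\<in>UNIV. c (inv_into UNIV h (h i)) *s h i)"
      using sum.reindex_bij_betw [OF h, of "\<lambda>v. c (inv_into UNIV h v) *s v"] by simp
    also have "\<dots> = 0"
      using that h by (simp add: col bij_betw_def)
    finally have "c (inv_into UNIV h (h i)) = 0"
      using vec.independentD [OF B'(2) fin(1) subset_refl, of "\<lambda>v. c (inv_into UNIV h v)" "h i"]
        h by (auto simp: bij_betw_def)
    then show ?thesis using h by (simp add: bij_betw_def)
  qed
  then have P: "invertible P"
    by (simp only: invertible_left_inverse matrix_left_invertible_independent_columns) blast
  show thesis
  proof
    show "column i P \<in> W" if "i \<in> I" for i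
      using that B(1) hI by (auto simp: col bij_betw_def)
    let ?U = "{v. \<forall>i. i \<notin> I \<longrightarrow> (matrix_inv P *v v) $ i = 0}"
    have "B \<subseteq> ?U"
    proof
      fix v assume "v \<in> B"
      then obtain j where j: "j \<in> I" "v = column j P"
        using hI by (auto simp: col bij_betw_def)
      have "matrix_inv P *v v = axis j 1"
        by (simp add: j(2) column_eq_mult_axis matrix_vector_mul_assoc matrix_inv_mult [OF P])
      then show "v \<in> ?U" using j(1) by (auto simp: axis_def)
    qed
    moreover have "vec.subspace ?U"
      by (auto simp: vec.subspace_def vec.add vec.scale)
    ultimately have "W \<subseteq> ?U"
      using B(3) vec.span_minimal by blast
    then show "(matrix_inv P *v v) $ i = 0" if "v \<in> W" "i \<notin> I" for v i
      using that by blast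
  qed (rule P)
qed

section \<open>Jordan bases for nilpotent matrices of type (3, 1)\<close>

lemma invertible_columns_4:
  fixes f1 :: "'a::field ^ 4"
  assumes "\<And>a b c d. a *s f1 + b *s f2 + c *s f3 + d *s f4 = 0 \<Longrightarrow>
    a = 0 \<and> b = 0 \<and> c = 0 \<and> d = 0"
  shows "invertible ((\<chi> i j. vector [f1, f2, f3, f4] $ j $ i) :: 'a ^ 4 ^ 4)"
proof -
  have col: "column j ((\<chi> i j. vector [f1, f2, f3, f4] $ j $ i) :: 'a ^ 4 ^ 4) = vector [f1, f2, f3, f4] $ j" for j :: 4
    by (simp add: column_def vec_eq_iff)
  have "\<forall>c. (\<Sum>i\<in>UNIV. c i *s vector [f1, f2, f3, f4] $ (i::4)) = 0 \<longrightarrow> (\<forall>i. c i = 0)"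
    using assms by (auto simp: sum_4 forall_4)
  then show ?thesis
    by (simp only: invertible_left_inverse matrix_left_invertible_independent_columns col)
qed

text \<open>
  The nilpotent Jordan matrix of type \<open>(3, 1)\<close>, with the basis ordered so that the one-dimensional
  block sits in the third place; this is the ordering that matches form (6).
\<close>

definition jordan_3_1 :: "'a::field ^ 4 ^ 4" where
  "jordan_3_1 = vector [vector [0, 1, 0, 0], vector [0, 0, 0, 1], vector [0, 0, 0, 0],
     vector [0, 0, 0, 0]]"

text \<open>A vector \<open>v\<close> not killed by \<open>X^2\<close> starts a chain of length
  three. A vector \<open>w\<close> outside its span is then corrected by chain vectors until it lies
  in the kernel of \<open>X\<close>.\<close>

lemma jordan_3_1_exists:
  fixes X :: "'a::field ^ 4 ^ 4"
  assumes X3: "X ** X ** X = 0" and X2: "X ** X \<noteq> 0"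
  obtains P where "invertible P" "X ** P = P ** jordan_3_1"
proof -
  obtain v where v: "X ** X *v v \<noteq> 0"
    using X2 by (metis matrix_eq matrix_vector_mult_0)
  define f1 f2 f3 where "f1 = X ** X *v v" and "f2 = X *v v" and "f3 = v"
  have X: "X *v f1 = 0" "X *v f2 = f1" "X *v f3 = f2" and f1: "f1 \<noteq> 0"
    using X3 v by (simp_all add: f1_def f2_def f3_def matrix_vector_mul_assoc matrix_mul_assoc)
  have lin: "X *v (u + w) = X *v u + X *v w" "X *v (c *s u) = c *s (X *v u)" for u w c
    by (simp_all add: vec.add vec.scale)
  have "vec.dim (vec.span {f1, f2, f3}) \<le> card {f1, f2, f3}"
    by (simp add: vec.dim_le_card')
  also have "\<dots> \<le> 3"
    by (metis card_length list.simps(15) empty_set length_Cons list.size(3) numeral_3_eq_3)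
  finally have dim: "vec.dim (vec.span {f1, f2, f3}) \<le> 3" .
  have "vec.dim (UNIV :: ('a ^ 4) set) = 4"
    by (simp only: vec_dim_card) simp
  with dim have "vec.span {f1, f2, f3} \<noteq> UNIV"
    by (metis numeral_le_iff semiring_norm(69,71,72,73))
  then obtain w where w: "w \<notin> vec.span {f1, f2, f3}" by auto
  have comb: "a *s f1 + b *s f2 + c *s f3 \<in> vec.span {f1, f2, f3}" for a b c
    by (intro vec.span_add vec.span_scale vec.span_base) auto
  \<comment> \<open>Kept general in \<open>g\<close>, as it serves both for the first choice
    \<open>w\<close> and for the corrected vector.\<close>
  have indep: "a = 0 \<and> b = 0 \<and> c = 0 \<and> d = 0"
    if *: "a *s f1 + b *s f2 + c *s g + d *s f3 = 0" and g: "g \<notin> vec.span {f1, f2, f3}" for a b c d g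
  proof -
    have c: "c = 0"
    proof (rule ccontr)
      assume "c \<noteq> 0"
      have "c *s g = (- a) *s f1 + (- b) *s f2 + (- d) *s f3"
        using * by (simp add: algebra_simps eq_neg_iff_add_eq_0)
      then have "c *s g \<in> vec.span {f1, f2, f3}" by (simp only: comb)
      then have "inverse c *s (c *s g) \<in> vec.span {f1, f2, f3}"
        by (rule vec.span_scale)
      with \<open>c \<noteq> 0\<close> g show False by simp
    qed
    \<comment> \<open>Applying \<open>X\<close> twice leaves \<open>d *s f1\<close>; once
      \<open>d = 0\<close>, applying it once leaves \<open>b *s f1\<close>.\<close>
    have "X *v (X *v (a *s f1 + b *s f2 + d *s f3)) = 0" "X *v (a *s f1 + b *s f2 + d *s f3) = 0"
      using * c by simp_all
    then have "d = 0" "b = 0"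
      using f1 by (simp_all add: lin X)
    with * c f1 show ?thesis by simp
  qed
  let ?P = "\<lambda>g. (\<chi> i j. vector [f1, f2, g, f3] $ j $ i) :: 'a ^ 4 ^ 4"
  have inv: "invertible (?P g)" if "g \<notin> vec.span {f1, f2, f3}" for g
    using indep that by (intro invertible_columns_4) blast
  define u where "u = matrix_inv (?P w) *v (X *v w)"
  have "?P w *v u = X *v w"
    using matrix_inv_mult(1) [OF inv [OF w]] by (simp add: u_def matrix_vector_mul_assoc matrix_mul_assoc)
  then have Xw: "X *v w = u $ 1 *s f1 + u $ 2 *s f2 + u $ 3 *s w + u $ 4 *s f3"
    by (simp add: vec_eq_iff matrix_vector_mult_def sum_4 forall_4 mult.commute)
  have "X *v (X *v (X *v w)) = 0"
    using X3 by (simp add: matrix_vector_mul_assoc matrix_mul_assoc)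
  \<comment> \<open>This expands \<open>X^3 w = 0\<close> in the basis \<open>f1, f2, w, f3\<close>.
    The coefficient of \<open>w\<close> is the cube of \<open>u $ 3\<close>; after that vanishes,
    the coefficient of \<open>f1\<close> is \<open>u $ 4\<close>.\<close>
  then have "(u $ 3 * (u $ 3 * u $ 1) + u $ 3 * u $ 2 + u $ 4) *s f1
      + (u $ 3 * (u $ 3 * u $ 2) + u $ 3 * u $ 4) *s f2
      + (u $ 3 * (u $ 3 * u $ 3)) *s w + (u $ 3 * (u $ 3 * u $ 4)) *s f3 = 0"
    by (simp add: Xw lin X vec_eq_iff algebra_simps)
  from indep [OF this w] have u: "u $ 3 = 0" "u $ 4 = 0" by auto
  \<comment> \<open>Now \<open>X w = u\<^sub>1 f1 + u\<^sub>2 f2\<close>, which is also the image of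
    \<open>u\<^sub>1 f2 + u\<^sub>2 f3\<close>.\<close>
  define g where "g = w - (u $ 1 *s f2 + u $ 2 *s f3)"
  have Xg: "X *v g = 0"
    by (simp add: g_def vec.diff lin X Xw u)
  have "g \<notin> vec.span {f1, f2, f3}"
  proof
    assume "g \<in> vec.span {f1, f2, f3}"
    then have "g + (0 *s f1 + u $ 1 *s f2 + u $ 2 *s f3) \<in> vec.span {f1, f2, f3}"
      using comb vec.span_add by blast
    with w show False by (simp add: g_def)
  qed
  moreover have "X ** ?P g = ?P g ** jordan_3_1"
    using X Xg by (simp add: vec_eq_iff matrix_matrix_mult_def matrix_vector_mult_def sum_4 forall_4
      jordan_3_1_def)
  ultimately show thesis using inv that by blast
qed

section \<open>Nilpotency of the coefficient matrices\<close>

lemma coeff_matrix_mult: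
  assumes "exponential_matrix A"
  shows "coeff_matrix A i ** coeff_matrix A j
    = map_matrix (\<lambda>c. of_nat ((i + j) choose i) * c) (coeff_matrix A (i + j))"
  using assms by (simp add: exponential_matrix_iff_coeff)

lemma coeff_matrix_commute:
  assumes "exponential_matrix A"
  shows "coeff_matrix A i ** coeff_matrix A j = coeff_matrix A j ** coeff_matrix A i"
  using binomial_symmetric [of i "i + j"]
  by (simp add: coeff_matrix_mult [OF assms] add.commute)

lemma coeff_matrix_cube:
  fixes A :: "'a::field poly ^ 'n ^ 'n"
  assumes char: "CHAR('a) = 3" and A: "exponential_matrix A" and n: "n > 0"
  shows "coeff_matrix A n ** coeff_matrix A n ** coeff_matrix A n = 0"
proof -
  have "(2 * n) * ((2 * n + n) choose (2 * n)) = (2 * n + n) * ((2 * n + n - 1) choose (2 * n - 1))"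
    using n Suc_times_binomial [of "2 * n - 1" "2 * n + n - 1"] by (simp del: binomial_Suc_Suc)
  then have "n * (2 * ((2 * n + n) choose (2 * n))) = n * (3 * ((2 * n + n - 1) choose (2 * n - 1)))"
    by (simp add: algebra_simps)
  then have "3 dvd 2 * ((2 * n + n) choose (2 * n))"
    using n by (metis dvd_triv_left mult_left_cancel less_irrefl)
  then have "3 dvd ((2 * n + n) choose (2 * n))"
    by presburger
  then have "of_nat ((2 * n + n) choose (2 * n)) = (0::'a)"
    by (simp only: of_nat_eq_0_iff_char_dvd char)
  moreover have "map_matrix ((*) c) M ** N = map_matrix ((*) c) (M ** N)" for c and M N :: "'a ^ 'n ^ 'n"
    by (simp add: vec_eq_iff matrix_matrix_mult_def sum_distrib_left mult_ac)
  moreover have "coeff_matrix A n ** coeff_matrix A n ** coeff_matrix A n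
      = map_matrix ((*) (of_nat ((n + n) choose n))) (coeff_matrix A (n + n) ** coeff_matrix A n)"
    by (simp add: coeff_matrix_mult [OF A, of n n] calculation(2))
  ultimately show ?thesis
    by (simp add: coeff_matrix_mult [OF A] vec_eq_iff flip: mult_2)
qed

lemma matrix_add_rdistrib: "(B + C) ** A = B ** A + C ** (A :: 'a::semiring_1 ^ 'n ^ 'm)"
  by (simp add: vec_eq_iff matrix_matrix_mult_def distrib_right sum.distrib)

text \<open>Commutativity makes both mixed terms of the expansion occur three times.\<close>

lemma cube_add_eq_0:
  fixes M N :: "'a::field ^ 'n ^ 'n"
  assumes char: "CHAR('a) = 3" and comm: "M ** N = N ** M"
    and cubes: "M ** M ** M = 0" "N ** N ** N = 0"
  shows "(M + N) ** (M + N) ** (M + N) = 0"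
proof -
  have three: "X + X + X = 0" for X :: "'a ^ 'n ^ 'n"
  proof -
    have "of_nat 3 = (0::'a)"
      by (simp only: of_nat_eq_0_iff_char_dvd char dvd_refl)
    moreover have "(X + X + X) $ i $ j = of_nat 3 * X $ i $ j" for i j
      by (simp add: algebra_simps)
    ultimately show ?thesis by (simp add: vec_eq_iff)
  qed
  have "M ** N ** M = M ** M ** N" "N ** M ** M = M ** M ** N"
    "N ** M ** N = M ** N ** N" "N ** N ** M = M ** N ** N"
    by (metis comm matrix_mul_assoc)+
  then have "(M + N) ** (M + N) ** (M + N)
      = (M ** M ** N + M ** M ** N + M ** M ** N) + (M ** N ** N + M ** N ** N + M ** N ** N)"
    by (simp add: matrix_add_ldistrib matrix_add_rdistrib cubes)
  then show ?thesis by (simp only: three add_0)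
qed

section \<open>All products of coefficient matrices vanish\<close>

text \<open>In a basis adapted to \<open>W\<close>, the matrix differs from the identity only in
  rows belonging to \<open>W\<close> and columns outside it. The dimension of \<open>W\<close>
  selects the shape of this block.\<close>

lemma square_zero_forms:
  fixes A :: "'a::field poly ^ 4 ^ 4"
  assumes p: "prime CHAR('a)" and A: "exponential_matrix A"
    and zero: "\<And>i j. i > 0 \<Longrightarrow> j > 0 \<Longrightarrow> coeff_matrix A i ** coeff_matrix A j = 0"
  shows "\<exists>B \<in> form3 \<union> form4 \<union> form5. equivalent_matrices A B"
proof -
  define W where "W = vec.span (\<Union>n\<in>{0<..}. range ((*v) (coeff_matrix A n)))"
  have im: "coeff_matrix A n *v v \<in> W" if "n > 0" for n v
    using that by (auto simp: W_def intro!: vec.span_base)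
  have ker: "coeff_matrix A n *v w = 0" if n: "n > 0" and w: "w \<in> W" for n w
  proof -
    have "vec.subspace {w. coeff_matrix A n *v w = 0}"
      by (auto simp: vec.subspace_def vec.add vec.scale)
    moreover have "(\<Union>m\<in>{0<..}. range ((*v) (coeff_matrix A m))) \<subseteq> {w. coeff_matrix A n *v w = 0}"
      using zero n by (auto simp: matrix_vector_mul_assoc)
    ultimately have "W \<subseteq> {w. coeff_matrix A n *v w = 0}"
      unfolding W_def by (rule vec.span_minimal [rotated])
    with w show ?thesis by blast
  qed
  have "vec.dim W \<le> 4"
    using vec.dim_subset [of W UNIV] by (simp only: vec_dim_card subset_UNIV simp_thms) simp
  \<comment> \<open>If \<open>W\<close> were everything, all \<open>M\<^sub>n\<close> with
    \<open>n > 0\<close> would vanish, and so would \<open>W\<close>.\<close>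
  moreover have "vec.dim W \<noteq> 4"
  proof
    assume "vec.dim W = 4"
    then have "W = UNIV"
      using vec.subspace_dim_equal [of W UNIV] by (simp only: vec_dim_card) (simp add: W_def)
    then have "coeff_matrix A n *v v = 0" if "n > 0" for n v
      using ker that by simp
    then have "W \<subseteq> {0}"
      unfolding W_def by (intro vec.span_minimal) auto
    with \<open>W = UNIV\<close> show False
      by (metis UNIV_I axis_eq_0_iff singletonD subsetD zero_neq_one)
  qed
  moreover have "d \<in> {0, 1, 2, 3}" if "d \<le> 4" "d \<noteq> 4" for d :: nat
    using that by auto
  ultimately have dim: "vec.dim W \<in> {0, 1, 2, 3}" by blast
  have "\<exists>(I :: 4 set) P. I \<in> {{1}, {1, 2}, {1, 2, 3}} \<and> invertible P \<and>
      (\<forall>n r s. n > 0 \<and> (r \<notin> I \<or> s \<in> I) \<longrightarrow> (matrix_inv P ** coeff_matrix A n ** P) $ r $ s = 0)"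
  proof (cases "vec.dim W = 0")
    case True
    then have "W \<subseteq> {0}" by simp
    then have "coeff_matrix A n *v v = 0" if "n > 0" for n v
      using im [OF that] by blast
    then have "coeff_matrix A n = 0" if "n > 0" for n
      using that by (simp add: matrix_eq)
    moreover have "invertible (mat 1 :: 'a ^ 4 ^ 4)"
      unfolding invertible_def by (rule exI [of _ "mat 1"]) simp
    \<comment> \<open>For \<open>W = 0\<close> the matrix is the identity; taking
      \<open>I = {1}\<close> files it under form (3) with zero entries.\<close>
    ultimately show ?thesis
      by (intro exI [of _ "{1}"] exI [of _ "mat 1 :: 'a ^ 4 ^ 4"]) simp
  next
    case False
    have cards: "card {1::4} = 1" "card {1, 2::4} = 2" "card {1, 2, 3::4} = 3" by auto
    obtain I :: "4 set" where I: "I \<in> {{1}, {1, 2}, {1, 2, 3}}" "card I = vec.dim W"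
      using dim False cards by (metis insertE insertI1 insertI2 singletonD)
    then obtain P where P: "invertible P"
      "\<And>v i. v \<in> W \<Longrightarrow> i \<notin> I \<Longrightarrow> (matrix_inv P *v v) $ i = 0"
      "\<And>i. i \<in> I \<Longrightarrow> column i P \<in> W"
      using adapted_basis by blast
    have col: "column s (matrix_inv P ** M ** P) = matrix_inv P *v (M *v column s P)" for M s
      by (simp add: column_eq_mult_axis matrix_vector_mul_assoc matrix_mul_assoc)
    have nth: "N $ r $ s = column s N $ r" for N :: "'a ^ 4 ^ 4" and r s
      by (simp add: column_def)
    \<comment> \<open>Rows outside \<open>I\<close> vanish because images lie in \<open>W\<close>;
      columns in \<open>I\<close> vanish because \<open>W\<close> is annihilated.\<close>
    have "(matrix_inv P ** coeff_matrix A n ** P) $ r $ s = 0" if "n > 0" "r \<notin> I \<or> s \<in> I" for n r s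
      unfolding nth col using that P(2) im [of n] ker [of n] P(3) [of s] by auto
    with I(1) P(1) show ?thesis
      by (intro exI [of _ I] exI [of _ P]) (simp del: insert_iff)
  qed
  then obtain I :: "4 set" and P where "I \<in> {{1}, {1, 2}, {1, 2, 3}} \<and> invertible P \<and>
      (\<forall>n r s. n > 0 \<and> (r \<notin> I \<or> s \<in> I) \<longrightarrow> (matrix_inv P ** coeff_matrix A n ** P) $ r $ s = 0)"
    by (elim exE)
  then have I: "I \<in> {{1}, {1, 2}, {1, 2, 3}}" and P: "invertible P"
    and entries: "\<And>n r s. n > 0 \<Longrightarrow> r \<notin> I \<or> s \<in> I \<Longrightarrow>
      (matrix_inv P ** coeff_matrix A n ** P) $ r $ s = 0"
    by simp_all
  define B where "B = const_matrix (matrix_inv P) ** A ** const_matrix P"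
  have AB: "equivalent_matrices A B"
    using P unfolding equivalent_matrices_def B_def const_matrix_def by blast
  have B: "exponential_matrix B"
    unfolding B_def using P A by (rule exponential_matrix_conj)
  have Bc: "coeff_matrix B n = matrix_inv P ** coeff_matrix A n ** P" for n
    by (simp add: B_def coeff_matrix_mult_const)
  have B0: "coeff_matrix B 0 = mat 1"
    using B by (simp add: exponential_matrix_iff_coeff)
  have triv: "B $ r $ s = (if r = s then 1 else 0)" if "r \<notin> I \<or> s \<in> I" for r s
  proof (rule poly_eqI)
    fix n
    have "coeff_matrix B n $ r $ s = (if n = 0 \<and> r = s then 1 else 0)"
    proof (cases "n = 0")
      case True
      then show ?thesis by (simp only: B0 mat_def) simp
    next
      case False
      then show ?thesis using entries [of n r s] that by (simp only: Bc) simp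
    qed
    then show "coeff (B $ r $ s) n = coeff (if r = s then 1 else 0) n"
      by (simp add: coeff_1)
  qed
  \<comment> \<open>In the product for this entry only the summands \<open>k = r\<close> and
    \<open>k = s\<close> survive, which is additivity.\<close>
  have pp: "p_polynomial (B $ r $ s)" if "r \<in> I" "s \<notin> I" for r s
  proof -
    have "subst_sum (B $ r $ s) = (\<Sum>k\<in>UNIV. subst_T (B $ r $ k) * subst_T' (B $ k $ s))"
      using B by (simp add: exponential_matrix_iff_subst)
    also have "\<dots> = (\<Sum>k\<in>UNIV. (if k = r then subst_T' (B $ r $ s) else 0)
        + (if k = s then subst_T (B $ r $ s) else 0))"
    proof (rule sum.cong)
      fix k show "subst_T (B $ r $ k) * subst_T' (B $ k $ s)
          = (if k = r then subst_T' (B $ r $ s) else 0) + (if k = s then subst_T (B $ r $ s) else 0)"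
        using that triv [of r k] triv [of k s] by (cases "k \<in> I") auto
    qed simp
    also have "\<dots> = subst_T' (B $ r $ s) + subst_T (B $ r $ s)"
      by (simp add: sum.distrib)
    finally show ?thesis
      by (intro additive_poly_imp_p_polynomial [OF p] additive_polyI) (simp add: add.commute)
  qed
  consider "I = {1}" | "I = {1, 2}" | "I = {1, 2, 3}" using I by blast
  then have "B \<in> form3 \<union> form4 \<union> form5"
  proof cases
    case 1
    then have "B = vector [vector [1, B $ 1 $ 2, B $ 1 $ 3, B $ 1 $ 4],
        vector [0, 1, 0, 0], vector [0, 0, 1, 0], vector [0, 0, 0, 1]]"
      by (simp add: vec_eq_iff forall_4 triv)
    then have "B \<in> form3" unfolding form3_def using pp 1 by force
    then show ?thesis by blast
  next
    case 2
    then have "B = vector [vector [1, 0, B $ 1 $ 3, B $ 1 $ 4],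
        vector [0, 1, B $ 2 $ 3, B $ 2 $ 4], vector [0, 0, 1, 0], vector [0, 0, 0, 1]]"
      by (simp add: vec_eq_iff forall_4 triv)
    then have "B \<in> form4" unfolding form4_def using pp 2 by force
    then show ?thesis by blast
  next
    case 3
    then have "B = vector [vector [1, 0, 0, B $ 1 $ 4],
        vector [0, 1, 0, B $ 2 $ 4], vector [0, 0, 1, B $ 3 $ 4], vector [0, 0, 0, 1]]"
      by (simp add: vec_eq_iff forall_4 triv)
    then have "B \<in> form5" unfolding form5_def using pp 3 by force
    then show ?thesis by blast
  qed
  with AB show ?thesis by blast
qed

section \<open>Some product of coefficient matrices does not vanish\<close>

text \<open>Commuting with the Jordan matrix leaves two diagonal values, one on each block. Their
  cubes are diagonal entries of \<open>C^3\<close>, so both vanish.\<close>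

lemma commutant_jordan_3_1:
  fixes C :: "'a::field ^ 4 ^ 4"
  assumes comm: "C ** jordan_3_1 = jordan_3_1 ** C" and cube: "C ** C ** C = 0"
  shows "C = vector [vector [0, C $ 1 $ 2, C $ 1 $ 3, C $ 1 $ 4], vector [0, 0, 0, C $ 1 $ 2],
    vector [0, 0, 0, C $ 3 $ 4], vector [0, 0, 0, 0]]"
proof -
  have entries: "C $ 2 $ 1 = 0" "C $ 1 $ 1 = C $ 2 $ 2" "C $ 2 $ 3 = 0" "C $ 1 $ 2 = C $ 2 $ 4"
    "C $ 4 $ 1 = 0" "C $ 4 $ 3 = 0" "C $ 4 $ 2 = 0" "C $ 2 $ 2 = C $ 4 $ 4"
    "C $ 3 $ 1 = 0" "C $ 3 $ 2 = 0"
    using comm by (simp_all add: vec_eq_iff forall_4 matrix_matrix_mult_def sum_4 jordan_3_1_def)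
  have "(C ** C ** C) $ 1 $ 1 = 0" "(C ** C ** C) $ 3 $ 3 = 0"
    by (simp_all add: cube)
  then have "C $ 2 $ 2 = 0" "C $ 3 $ 3 = 0"
    using entries by (simp_all add: matrix_matrix_mult_def sum_4)
  with entries show ?thesis
    by (simp add: vec_eq_iff forall_4)
qed

text \<open>The hypothesis says that the 2 by 2 minors of the two coefficient sequences vanish, so
  the ratio at one nonzero coefficient of \<open>e\<close> is valid at all indices.\<close>

lemma proportional_polys:
  fixes d e :: "'a::field poly"
  assumes eq: "\<And>i j. coeff e i * coeff d j = coeff e j * coeff d i" and e: "e \<noteq> 0"
  obtains t where "d = smult t e"
proof -
  obtain k where k: "coeff e k \<noteq> 0"
    using e by (auto simp: poly_eq_iff)
  have "d = smult (coeff d k / coeff e k) e"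
    using eq [of k] k by (simp add: poly_eq_iff field_simps)
  then show thesis using that by blast
qed

text \<open>For additive \<open>b\<close>, passing to \<open>T + T'\<close> in
  \<open>b^2 / 2\<close> creates exactly the cross term \<open>b(T) b(T')\<close>; subtracting the
  two squares therefore makes the corner entry additive.\<close>

lemma additive_poly_corner:
  fixes b c e :: "'a::field poly"
  assumes two: "(2::'a) \<noteq> 0" and b: "additive_poly b" and e: "additive_poly e"
    and c: "subst_sum c = subst_T c + subst_T' c + subst_T b * subst_T' b
      + const2 t * (subst_T e * subst_T' e)"
  shows "additive_poly (c - smult (1 / 2) (b\<^sup>2) - smult (t / 2) (e\<^sup>2))"
proof -
  obtain h where h: "additive_poly h" "b = h + h"
      "\<And>c. smult (c / 2) (b\<^sup>2) = smult c (h * h) + smult c (h * h)"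
    using additive_poly_half [OF two b] by blast
  obtain k where k: "additive_poly k" "e = k + k"
      "\<And>c. smult (c / 2) (e\<^sup>2) = smult c (k * k) + smult c (k * k)"
    using additive_poly_half [OF two e] by blast
  show ?thesis
    using h(1) k(1) unfolding additive_poly_def h(3) k(3)
    by (simp add: c h(2) k(2) algebra_simps)
qed

lemma cubic_forms:
  fixes A :: "'a::field poly ^ 4 ^ 4"
  assumes char: "CHAR('a) = 3" and A: "exponential_matrix A" and ij: "i > 0" "j > 0"
    and nonzero: "(coeff_matrix A i + coeff_matrix A j) ** (coeff_matrix A i + coeff_matrix A j) \<noteq> 0"
  shows "\<exists>B \<in> form1 \<union> form2 \<union> form6. equivalent_matrices A B"
proof -
  have p: "prime CHAR('a)" by (simp add: char)
  have two: "(2::'a) \<noteq> 0"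
    using of_nat_eq_0_iff_char_dvd [where 'a = 'a, of 2] char by simp
  let ?X = "coeff_matrix A i + coeff_matrix A j"
  have "?X ** ?X ** ?X = 0"
    by (intro cube_add_eq_0 [OF char] coeff_matrix_commute [OF A] coeff_matrix_cube [OF char A] ij)
  then obtain P where P: "invertible P" and XP: "?X ** P = P ** jordan_3_1"
    using jordan_3_1_exists nonzero by blast
  define B where "B = const_matrix (matrix_inv P) ** A ** const_matrix P"
  have AB: "equivalent_matrices A B"
    using P unfolding equivalent_matrices_def B_def const_matrix_def by blast
  have B: "exponential_matrix B"
    unfolding B_def using P A by (rule exponential_matrix_conj)
  have Bc: "coeff_matrix B n = matrix_inv P ** coeff_matrix A n ** P" for n
    by (simp add: B_def coeff_matrix_mult_const)
  have "coeff_matrix B i + coeff_matrix B j = matrix_inv P ** (?X ** P)"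
    by (simp add: Bc matrix_add_ldistrib matrix_add_rdistrib matrix_mul_assoc)
  also have "\<dots> = jordan_3_1"
    by (simp add: XP matrix_mul_assoc matrix_inv_mult [OF P])
  finally have J: "coeff_matrix B i + coeff_matrix B j = jordan_3_1" .
  have B0: "coeff_matrix B 0 = mat 1"
    using B by (simp add: exponential_matrix_iff_coeff)
  define b c d e where "b = B $ 1 $ 2" and "c = B $ 1 $ 4" and "d = B $ 3 $ 4" and "e = B $ 1 $ 3"
  have Bn: "coeff_matrix B n = vector [vector [0, coeff b n, coeff e n, coeff c n],
      vector [0, 0, 0, coeff b n], vector [0, 0, 0, coeff d n], vector [0, 0, 0, 0]]"
    if "n > 0" for n
  proof -
    \<comment> \<open>The Jordan matrix is itself a sum of two coefficient matrices of
      \<open>B\<close>, and these all commute.\<close>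
    have "coeff_matrix B n ** jordan_3_1 = jordan_3_1 ** coeff_matrix B n"
      by (simp add: J [symmetric] matrix_add_ldistrib matrix_add_rdistrib
        coeff_matrix_commute [OF B, of n])
    from commutant_jordan_3_1 [OF this coeff_matrix_cube [OF char B that]]
    show ?thesis by (simp add: b_def c_def d_def e_def)
  qed
  have B_eq: "B = vector [vector [1, b, e, c], vector [0, 1, 0, b], vector [0, 0, 1, d],
      vector [0, 0, 0, 1]]"
  proof (rule coeff_matrix_eqI)
    fix n show "coeff_matrix B n = coeff_matrix (vector [vector [1, b, e, c], vector [0, 1, 0, b],
        vector [0, 0, 1, d], vector [0, 0, 0, 1]]) n"
    proof (cases "n = 0")
      case True
      have "coeff b 0 = 0" "coeff c 0 = 0" "coeff d 0 = 0" "coeff e 0 = 0"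
        using B0 by (simp_all add: b_def c_def d_def e_def vec_eq_iff forall_4 mat_def)
      then show ?thesis
        by (simp add: True B0 vec_eq_iff forall_4 mat_def)
    next
      case False
      then show ?thesis
        by (simp add: Bn) (simp add: vec_eq_iff forall_4 coeff_1)
    qed
  qed
  have subst: "subst_sum b = subst_T b + subst_T' b" "subst_sum d = subst_T d + subst_T' d"
    "subst_sum e = subst_T e + subst_T' e"
    "subst_sum c = subst_T c + subst_T' c + subst_T b * subst_T' b + subst_T e * subst_T' d"
    using B unfolding exponential_matrix_iff_subst
    by (simp_all add: B_eq forall_4 sum_4 add_ac)
  then have add: "additive_poly b" "additive_poly d" "additive_poly e"
    by (simp_all add: additive_poly_def)
  then have coeff0: "coeff b 0 = 0" "coeff d 0 = 0" "coeff e 0 = 0"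
    using poly_0_additive by (auto simp: poly_0_coeff_0)
  note pp = additive_poly_imp_p_polynomial [OF p]
  have J': "coeff b i + coeff b j = 1" "coeff e i + coeff e j = 0" "coeff d i + coeff d j = 0"
    using J ij by (simp_all add: Bn vec_eq_iff forall_4 jordan_3_1_def)
  then have b: "b \<noteq> 0" by auto
  \<comment> \<open>The corner entry of \<open>M\<^sub>m M\<^sub>n\<close> is
    \<open>b\<^sub>m b\<^sub>n + e\<^sub>m d\<^sub>n\<close>, and it is symmetric in
    \<open>m\<close> and \<open>n\<close>.\<close>
  have ed: "coeff e m * coeff d n = coeff e n * coeff d m" for m n
  proof (cases "m = 0 \<or> n = 0")
    case False
    then have "(coeff_matrix B m ** coeff_matrix B n) $ 1 $ 4
        = (coeff_matrix B n ** coeff_matrix B m) $ 1 $ 4"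
      using coeff_matrix_commute [OF B] by metis
    with False show ?thesis
      by (simp add: Bn matrix_matrix_mult_def sum_4 mult.commute)
  qed (auto simp: coeff0)
  consider "e = 0" | "d = 0" | t where "e \<noteq> 0" "d \<noteq> 0" "d = smult t e"
    using proportional_polys [OF ed] by metis
  then show ?thesis
  proof cases
    case 1
    let ?f = "c - smult (1 / 2) (b\<^sup>2)"
    let ?F = "vector [vector [1, 0, 0, d], vector [0, 1, b, smult (1 / 2) (b\<^sup>2) + ?f],
      vector [0, 0, 1, b], vector [0, 0, 0, 1]] :: 'a poly ^ 4 ^ 4"
    \<comment> \<open>This permutation moves the third basis vector to the front.\<close>
    let ?Q = "vector [vector [0, 1, 0, 0], vector [0, 0, 1, 0], vector [1, 0, 0, 0],
      vector [0, 0, 0, 1]] :: 'a ^ 4 ^ 4"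
    have "additive_poly ?f"
      \<comment> \<open>With \<open>t = 0\<close> the second square drops out, and \<open>b\<close>
        merely fills the place of \<open>e\<close>.\<close>
      using additive_poly_corner [OF two add(1) add(1), of c 0] subst(4) 1
      by (simp add: const2_def)
    then have F: "?F \<in> form2"
      unfolding form2_def using pp add b by blast
    have "invertible ?Q" unfolding invertible_def
      by (rule exI [of _ "transpose ?Q"])
        (simp add: vec_eq_iff forall_4 matrix_matrix_mult_def sum_4 transpose_def mat_def)
    moreover have "B ** const_matrix ?Q = const_matrix ?Q ** ?F"
      unfolding B_eq 1
      by (simp add: vec_eq_iff forall_4 matrix_matrix_mult_def sum_4 flip: one_pCons)
    ultimately show ?thesis
      using F AB equivalent_matricesI equivalent_matrices_trans by blast
  next
    case 2
    let ?f = "c - smult (1 / 2) (b\<^sup>2)"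
    let ?F = "vector [vector [1, b, smult (1 / 2) (b\<^sup>2) + ?f, e], vector [0, 1, b, 0],
      vector [0, 0, 1, 0], vector [0, 0, 0, 1]] :: 'a poly ^ 4 ^ 4"
    \<comment> \<open>This permutation exchanges the last two basis vectors.\<close>
    let ?Q = "vector [vector [1, 0, 0, 0], vector [0, 1, 0, 0], vector [0, 0, 0, 1],
      vector [0, 0, 1, 0]] :: 'a ^ 4 ^ 4"
    have "additive_poly ?f"
      using additive_poly_corner [OF two add(1) add(1), of c 0] subst(4) 2
      by (simp add: const2_def)
    then have F: "?F \<in> form1"
      unfolding form1_def using pp add b by blast
    have "invertible ?Q" unfolding invertible_def
      by (rule exI [of _ "transpose ?Q"])
        (simp add: vec_eq_iff forall_4 matrix_matrix_mult_def sum_4 transpose_def mat_def)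
    moreover have "B ** const_matrix ?Q = const_matrix ?Q ** ?F"
      unfolding B_eq 2
      by (simp add: vec_eq_iff forall_4 matrix_matrix_mult_def sum_4 flip: one_pCons)
    ultimately show ?thesis
      using F AB equivalent_matricesI equivalent_matrices_trans by blast
  next
    case (3 t)
    let ?f = "c - smult (1 / 2) (b\<^sup>2) - smult (t / 2) (e\<^sup>2)"
    have "additive_poly ?f"
      using additive_poly_corner [OF two add(1,3), of c t] subst(4) 3(3)
      by (simp add: mult_ac)
    \<comment> \<open>The coefficient functionals of \<open>b\<close> and \<open>e\<close> take the values 1 and 0 on \<open>X\<close>.\<close>
    moreover have "lin_indep2 b e" unfolding lin_indep2_def
    proof (intro allI impI)
      fix \<alpha> \<beta> assume zero: "smult \<alpha> b + smult \<beta> e = 0"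
      have "\<alpha> * coeff b n + \<beta> * coeff e n = 0" for n
        using arg_cong [OF zero, of "\<lambda>f. coeff f n"] by simp
      then have sums: "(\<alpha> * coeff b i + \<beta> * coeff e i) + (\<alpha> * coeff b j + \<beta> * coeff e j) = 0"
        by (simp only: add_0)
      have "\<alpha> * (coeff b i + coeff b j) + \<beta> * (coeff e i + coeff e j) = 0"
        using sums by (simp only: distrib_left add_ac)
      then have "\<alpha> = 0" by (simp add: J')
      with zero 3(1) show "\<alpha> = 0 \<and> \<beta> = 0" by simp
    qed
    \<comment> \<open>With the parameters \<open>1, 0, t\<close> the determinant is
      \<open>t\<close>, nonzero since \<open>d = smult t e\<close> is nonzero.\<close>
    moreover have "1 * t - 0\<^sup>2 \<noteq> 0" using 3(2,3) by auto
    moreover have "B = vector [vector [1, b, e, smult (1 / 2) (b\<^sup>2) + smult 0 (b * e)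
          + smult (t / 2) (e\<^sup>2) + ?f],
        vector [0, 1, 0, smult 1 b + smult 0 e], vector [0, 0, 1, smult 0 b + smult t e],
        vector [0, 0, 0, 1]]"
      unfolding B_eq by (simp add: 3(3))
    ultimately have "B \<in> form6"
      unfolding form6_def using pp add by blast
    with AB show ?thesis by blast
  qed
qed

section \<open>Combining the square-zero and the cubic case\<close>

theorem theorem4p4:
  assumes "CHAR('a::field) = 3"
  shows "(\<forall>B \<in> form1 \<union> form2 \<union> form3 \<union> form4 \<union> form5 \<union> form6.
            exponential_matrix (B :: 'a poly ^ 4 ^ 4)) \<and>
         (\<forall>A :: 'a poly ^ 4 ^ 4. exponential_matrix A \<longrightarrow>
            (\<exists>B \<in> form1 \<union> form2 \<union> form3 \<union> form4 \<union> form5 \<union> form6.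
               equivalent_matrices A B))"
proof (intro conjI ballI allI impI)
  have p: "prime CHAR('a)" by (simp add: assms)
  have two: "(2::'a) \<noteq> 0"
    using of_nat_eq_0_iff_char_dvd [where 'a = 'a, of 2] assms by simp
  show "exponential_matrix B"
    if "B \<in> form1 \<union> form2 \<union> form3 \<union> form4 \<union> form5 \<union> form6" for B :: "'a poly ^ 4 ^ 4"
    using forms_exponential [OF p two that] .
  fix A :: "'a poly ^ 4 ^ 4" assume A: "exponential_matrix A"
  show "\<exists>B \<in> form1 \<union> form2 \<union> form3 \<union> form4 \<union> form5 \<union> form6. equivalent_matrices A B"
  proof (cases "\<exists>i j. i > 0 \<and> j > 0 \<and>
      (coeff_matrix A i + coeff_matrix A j) ** (coeff_matrix A i + coeff_matrix A j) \<noteq> 0")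
    case True
    then show ?thesis using cubic_forms [OF assms A] by blast
  next
    case False
    have half: "X = 0" if "X + X = 0" for X :: "'a ^ 4 ^ 4"
    proof -
      have "2 * X $ r $ s = 0" for r s
        using arg_cong [OF that, of "\<lambda>X. X $ r $ s"] by (simp only: mult_2 vector_add_component zero_index)
      with two show ?thesis by (simp add: vec_eq_iff)
    qed
    have sq: "coeff_matrix A i ** coeff_matrix A i = 0" if "i > 0" for i
    \<comment> \<open>The case \<open>j = i\<close> of the assumption reads
      \<open>4 M\<^sub>i^2 = 0\<close>, so 2 is cancelled twice.\<close>
    proof (rule half, rule half)
      have "(coeff_matrix A i + coeff_matrix A i) ** (coeff_matrix A i + coeff_matrix A i) = 0"
        using False that by blast
      then show "coeff_matrix A i ** coeff_matrix A i + coeff_matrix A i ** coeff_matrix A i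
          + (coeff_matrix A i ** coeff_matrix A i + coeff_matrix A i ** coeff_matrix A i) = 0"
        by (simp only: matrix_add_ldistrib matrix_add_rdistrib)
    qed
    have "coeff_matrix A i ** coeff_matrix A j = 0" if "i > 0" "j > 0" for i j
    \<comment> \<open>Once the squares are gone, \<open>(M\<^sub>i + M\<^sub>j)^2\<close> equals
      \<open>2 M\<^sub>i M\<^sub>j\<close> by commutativity.\<close>
    proof (rule half)
      have "(coeff_matrix A i + coeff_matrix A j) ** (coeff_matrix A i + coeff_matrix A j) = 0"
        using False that by blast
      then show "coeff_matrix A i ** coeff_matrix A j + coeff_matrix A i ** coeff_matrix A j = 0"
        by (simp add: matrix_add_ldistrib matrix_add_rdistrib sq that
          coeff_matrix_commute [OF A, of j i])
    qed
    then show ?thesis using square_zero_forms [OF p A] by blast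
  qed
qed

end
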